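(* If $f\in\mathcal{B}\setminus H^\infty$, then there exists $g\in B^1$ such that $g\cdot f\notin\mathcal{B}$.
   Context: $\mathbb{D}=\{z\in\mathbb{C}:|z|<1\}$ is the open unit disc. $\mathcal{B}$ (the Bloch space) is the space of all functions $f$ analytic in $\mathbb{D}$ with $|f(0)|+\sup_{z\in\mathbb{D}}(1-|z|^2)|f'(z)|<\infty$. $H^\infty$ is the space of all bounded analytic functions in $\mathbb{D}$. $B^1$ (the minimal Besov space) is the space of all functions $f$ analytic in $\mathbb{D}$ with $\int_{\mathbb{D}}|f''(z)|\,dA(z)<\infty$, where $dA$ denotes the area measure on $\mathbb{D}$. $g\cdot f$ denotes the pointwise product. *)

theory Defs
  imports "HOL-Complex_Analysis.Complex_Analysis"
begin

text \<open>
  The open unit disc is \<open>ball 0 1\<close>. A function on the disc is represented by a total function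
  on the complex plane; its values off the disc are irrelevant, since the spaces below depend only
  on its restriction to the (open) disc.
\<close>

text \<open>The supremum is taken in \<open>ennreal\<close>, so it is infinite when the family is unbounded.\<close>

definition bloch_space :: "(complex \<Rightarrow> complex) set" where
  "bloch_space = {f. f analytic_on ball 0 1 \<and>
     ennreal (norm (f 0)) + (SUP z\<in>ball 0 1. ennreal ((1 - (norm z)\<^sup>2) * norm (deriv f z))) < \<infinity>}"

definition H_infinity :: "(complex \<Rightarrow> complex) set" where
  "H_infinity = {f. f analytic_on ball 0 1 \<and> bounded (f ` ball 0 1)}"

definition min_besov_space :: "(complex \<Rightarrow> complex) set" where
  "min_besov_space = {f. f analytic_on ball 0 1 \<and>
     (\<integral>\<^sup>+z\<in>ball 0 1. ennreal (norm (deriv (deriv f) z)) \<partial>lborel) < \<infinity>}"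

end

theory Submission
  imports Defs
begin

text \<open>
  Put \<open>\<phi>\<^sub>a(z) = (1 - |a|\<^sup>2) / (1 - cnj a z)\<close>. The functions \<open>\<phi>\<^sub>a\<close> are uniformly bounded, their
  second derivatives have uniformly bounded integrals, and \<open>(1 - |a|\<^sup>2) |\<phi>\<^sub>a'(a)| = |a|\<close>.
  As \<open>f\<close> is bounded on compact subsets of the disc, there are points \<open>a\<^sub>n\<close> tending to the
  circle as rapidly as desired with \<open>|f(a\<^sub>n)| \<ge> 4\<^sup>n\<close>. For \<open>g = \<Sum> 2\<^sup>-\<^sup>n \<phi>\<^sub>a\<^sub>n\<close> a gliding hump estimate
  gives \<open>(1 - |a\<^sub>n|\<^sup>2) |g'(a\<^sub>n)| \<ge> 2\<^sup>-\<^sup>n / 5\<close>, so \<open>(1 - |z|\<^sup>2) |g'(z) f(z)|\<close> is unbounded, while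
  \<open>(1 - |z|\<^sup>2) |g(z) f'(z)|\<close> is bounded because \<open>g\<close> is.
\<close>

section \<open>Estimates for the kernel \<open>1 - cnj a * z\<close> and an area integral\<close>

text \<open>Both come from the reverse triangle inequality. The first bound is uniform in
  \<open>z\<close>, the second uniform in \<open>a\<close>; the series estimates need each of
  them.\<close>

lemma norm_one_minus_cnj_mult_ge:
  fixes a z :: complex
  assumes "norm a < 1" "norm z < 1"
  shows "1 - norm a \<le> norm (1 - cnj a * z)" "1 - norm z \<le> norm (1 - cnj a * z)"
proof -
  have *: "1 - norm a * norm z \<le> norm (1 - cnj a * z)"
    using norm_triangle_ineq2[of 1 "cnj a * z"] by (simp add: norm_mult)
  have "norm a * norm z \<le> norm a * 1" by (intro mult_left_mono) (use assms in auto)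
  with * show "1 - norm a \<le> norm (1 - cnj a * z)" by simp
  have "norm a * norm z \<le> 1 * norm z" by (intro mult_right_mono) (use assms in auto)
  with * show "1 - norm z \<le> norm (1 - cnj a * z)" by simp
qed

text \<open>Take the least \<open>k\<close> with \<open>w / d < 2 ^ k\<close>. It is positive
  because \<open>w / d \<ge> 1\<close>, and its predecessor is the required scale.\<close>

lemma dyadic_scale:
  fixes d w :: real
  assumes "0 < d" "d \<le> w"
  obtains j where "2 ^ j * d \<le> w" "w < 2 ^ Suc j * d"
proof -
  obtain m where m: "w / d < 2 ^ m"
    using real_arch_pow[of 2 "w / d"] by auto
  define k where "k = (LEAST k. w / d < 2 ^ k)"
  have k: "w / d < 2 ^ k" unfolding k_def using m by (rule LeastI)
  have "k \<noteq> 0" using k assms by (intro notI) (simp add: field_simps)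
  then obtain j where j: "k = Suc j" using not0_implies_Suc by blast
  have "\<not> w / d < 2 ^ j"
    using not_less_Least[of j "\<lambda>k. w / d < 2 ^ k"] j k_def by simp
  with k j that[of j] assms show thesis by (simp add: field_simps)
qed

text \<open>No change of variables is needed: \<open>|1 - cnj a z| < \<rho>\<close> says that \<open>z\<close> lies in a ball of
  radius \<open>\<rho> / |a|\<close> around \<open>1 / cnj a\<close>, so it suffices to sum over the dyadic values of \<open>\<rho>\<close>.\<close>

lemma nn_integral_kernel_le:
  assumes "1 / 2 \<le> norm a" "norm a < 1"
  shows "(\<integral>\<^sup>+z\<in>ball 0 1. ennreal ((1 - norm a) / norm (1 - cnj a * z) ^ 3) \<partial>lborel) \<le> ennreal (32 * pi)"
proof -
  define d where "d = 1 - norm a"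
  have d: "0 < d" using assms by (simp add: d_def)
  have a0: "a \<noteq> 0" using assms by auto
  \<comment> \<open>The shell at scale \<open>j\<close> has \<open>\<rho> = 2 ^ (j + 1) * d\<close>;
    since \<open>norm a \<ge> 1 / 2\<close>, the radius \<open>\<rho> / norm a\<close> is at most
    \<open>2 * \<rho>\<close>. The number \<open>c j\<close> below bounds the integrand on that
    shell.\<close>
  define B where "B j = ball (1 / cnj a) (2 ^ (j + 2) * d)" for j :: nat
  define c where "c j = d / (2 ^ j * d) ^ 3" for j :: nat
  have "(\<integral>\<^sup>+z\<in>ball 0 1. ennreal (d / norm (1 - cnj a * z) ^ 3) \<partial>lborel)
      \<le> (\<integral>\<^sup>+z. (\<Sum>j. ennreal (c j) * indicator (B j) z) \<partial>lborel)"
  proof (rule nn_integral_mono)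
    fix z :: complex
    show "ennreal (d / norm (1 - cnj a * z) ^ 3) * indicator (ball 0 1) z
        \<le> (\<Sum>j. ennreal (c j) * indicator (B j) z)"
    proof (cases "z \<in> ball 0 1")
      case True
      then have z: "norm z < 1" by simp
      define w where "w = norm (1 - cnj a * z)"
      have dw: "d \<le> w" using norm_one_minus_cnj_mult_ge(1)[OF assms(2) z] by (simp add: d_def w_def)
      obtain j where j: "2 ^ j * d \<le> w" "w < 2 ^ Suc j * d" using dyadic_scale[OF d dw] by blast
      have "1 - cnj a * z = cnj a * (1 / cnj a - z)" using a0 by (simp add: field_simps)
      then have "w = norm a * norm (1 / cnj a - z)"
        unfolding w_def by (metis norm_mult complex_mod_cnj)
      moreover have "1 / 2 * norm (1 / cnj a - z) \<le> norm a * norm (1 / cnj a - z)"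
        using assms by (intro mult_right_mono) auto
      ultimately have "norm (1 / cnj a - z) < 2 ^ (j + 2) * d" using j(2) by simp
      then have zB: "z \<in> B j" by (simp add: B_def dist_norm)
      have "d / w ^ 3 \<le> c j" unfolding c_def
        using d dw j(1) by (intro divide_left_mono power_mono mult_pos_pos) auto
      then have "ennreal (d / w ^ 3) \<le> ennreal (c j) * indicator (B j) z"
        using zB by (simp add: ennreal_leI)
      also have "\<dots> \<le> (\<Sum>j. ennreal (c j) * indicator (B j) z)"
        using sum_le_suminf[of "\<lambda>j. ennreal (c j) * indicator (B j) z" "{j}"]
        by (simp del: sum_mult_indicator)
      finally show ?thesis using True by (simp add: w_def)
    qed simp
  qed
  also have "\<dots> = (\<Sum>j. \<integral>\<^sup>+z. ennreal (c j) * indicator (B j) z \<partial>lborel)"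
    by (intro nn_integral_suminf borel_measurable_times_ennreal borel_measurable_indicator) (auto simp: B_def)
  also have "\<dots> = (\<Sum>j. ennreal (16 * pi * (1 / 2) ^ j))"
  proof (intro suminf_cong)
    fix j
    have "(\<integral>\<^sup>+z. ennreal (c j) * indicator (B j) z \<partial>lborel) = ennreal (c j) * emeasure lborel (B j)"
      by (simp add: B_def nn_integral_cmult_indicator)
    also have "emeasure lborel (B j) = ennreal (pi * (2 ^ (j + 2) * d) ^ 2)"
      using d by (simp add: B_def emeasure_ball unit_ball_vol_2)
    also have "ennreal (c j) * \<dots> = ennreal (c j * (pi * (2 ^ (j + 2) * d) ^ 2))"
      using d by (intro ennreal_mult[symmetric]) (auto simp: c_def)
    \<comment> \<open>The area grows like \<open>4 ^ j\<close> while \<open>c j\<close> decays like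
      \<open>8 ^ (-j)\<close>, and all powers of \<open>d\<close> cancel; hence a geometric series
      whose sum does not depend on \<open>a\<close>.\<close>
    also have "c j * (pi * (2 ^ (j + 2) * d) ^ 2) = 16 * pi * (1 / 2) ^ j"
      using d by (simp add: c_def field_simps power2_eq_square power3_eq_cube)
    finally show "(\<integral>\<^sup>+z. ennreal (c j) * indicator (B j) z \<partial>lborel) = ennreal (16 * pi * (1 / 2) ^ j)" .
  qed
  also have "\<dots> = ennreal (32 * pi)"
  proof (rule suminf_ennreal_eq)
    show "(\<lambda>j. 16 * pi * (1 / 2) ^ j) sums (32 * pi)"
      using sums_mult[OF geometric_sums[of "1 / 2 :: real"], of "16 * pi"] by simp
  qed simp
  finally show ?thesis by (simp add: d_def)
qed

section \<open>Termwise differentiation of series on the disc\<close>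

text \<open>The bound may blow up at the circle, but on a smaller disc of radius \<open>r\<close>
  monotonicity replaces \<open>C (norm z)\<close> by the constant \<open>C r\<close>, so the
  Weierstrass M-test applies there.\<close>

lemma has_field_derivative_suminf_ball:
  fixes F F' :: "nat \<Rightarrow> complex \<Rightarrow> complex"
  assumes der: "\<And>n z. norm z < 1 \<Longrightarrow> (F n has_field_derivative F' n z) (at z)"
    and bd: "\<And>n z. norm z < 1 \<Longrightarrow> norm (F' n z) \<le> M n * C (norm z)"
    and M: "summable M" "\<And>n. 0 \<le> M n"
    and C: "mono_on {..<1} C"
    and F0: "summable (\<lambda>n. F n 0)"
    and z: "norm z < 1"
  shows "((\<lambda>z. \<Sum>n. F n z) has_field_derivative (\<Sum>n. F' n z)) (at z)"
proof -
  obtain r where r: "norm z < r" "r < 1" using z dense by blast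
  have r0: "0 < r" using r(1) norm_ge_zero[of z] by linarith
  have unif: "uniformly_convergent_on (ball 0 r) (\<lambda>n x. \<Sum>i<n. F' i x)"
  proof (rule Weierstrass_m_test')
    show "norm (F' n x) \<le> M n * C r" if "x \<in> ball 0 r" for n x
    proof -
      have x: "norm x < r" using that by simp
      have "norm (F' n x) \<le> M n * C (norm x)" using bd[of x n] x r by simp
      also have "\<dots> \<le> M n * C r"
        using x r by (intro mult_left_mono mono_onD[OF C] M) auto
      finally show ?thesis .
    qed
    show "summable (\<lambda>n. M n * C r)" using M by (intro summable_mult2)
  qed
  show ?thesis
  proof (rule has_field_derivative_series'(2)[where S = "ball 0 r" and f = F and f' = F' and ?x0.0 = 0])
    show "(F n has_field_derivative F' n x) (at x within ball 0 r)" if "x \<in> ball 0 r" for n x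
      by (rule has_field_derivative_at_within[OF der]) (use that r in simp)
    show "0 \<in> ball (0::complex) r" using r0 by simp
    show "z \<in> interior (ball 0 r)" using r by (simp add: interior_open)
  qed (use unif F0 in auto)
qed

section \<open>The atoms and their first two derivatives\<close>

text \<open>The Szego kernel of the disc at \<open>a\<close>, scaled to take the value 1 at
  \<open>z = a\<close>.\<close>

definition besov_atom :: "complex \<Rightarrow> complex \<Rightarrow> complex" where
  "besov_atom a z = of_real (1 - (norm a)\<^sup>2) / (1 - cnj a * z)"

definition besov_atom' :: "complex \<Rightarrow> complex \<Rightarrow> complex" where
  "besov_atom' a z = of_real (1 - (norm a)\<^sup>2) * cnj a / (1 - cnj a * z) ^ 2"

definition besov_atom'' :: "complex \<Rightarrow> complex \<Rightarrow> complex" where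
  "besov_atom'' a z = 2 * of_real (1 - (norm a)\<^sup>2) * (cnj a) ^ 2 / (1 - cnj a * z) ^ 3"

lemma one_minus_norm_sq_bounds:
  assumes "norm a < 1"
  shows "0 < 1 - (norm a)\<^sup>2" "1 - (norm a)\<^sup>2 \<le> 2 * (1 - norm a)"
proof -
  have "1 - (norm a)\<^sup>2 = (1 + norm a) * (1 - norm a)" by (simp add: algebra_simps power2_eq_square)
  moreover have "(1 + norm a) * (1 - norm a) \<le> 2 * (1 - norm a)"
    using assms by (intro mult_right_mono) auto
  moreover have "0 < (1 + norm a) * (1 - norm a)"
    using assms by (intro mult_pos_pos) (auto intro: add_pos_nonneg)
  ultimately show "0 < 1 - (norm a)\<^sup>2" "1 - (norm a)\<^sup>2 \<le> 2 * (1 - norm a)" by auto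
qed

context
  fixes a z :: complex
  assumes a: "norm a < 1" and z: "norm z < 1"
begin

lemma one_minus_cnj_mult_nonzero: "1 - cnj a * z \<noteq> 0"
  using norm_one_minus_cnj_mult_ge(1)[OF a z] a by auto

lemma besov_atom_deriv: "(besov_atom a has_field_derivative besov_atom' a z) (at z)"
  unfolding besov_atom_def [abs_def] besov_atom'_def using one_minus_cnj_mult_nonzero
  by (auto intro!: derivative_eq_intros simp: power2_eq_square)

lemma besov_atom'_deriv: "(besov_atom' a has_field_derivative besov_atom'' a z) (at z)"
proof -
  define k where "k = complex_of_real (1 - (norm a)\<^sup>2) * cnj a"
  define w where "w = 1 - cnj a * z"
  have w: "w \<noteq> 0" unfolding w_def by (rule one_minus_cnj_mult_nonzero)
  have "((\<lambda>z. k / (1 - cnj a * z) ^ 2) has_field_derivative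
      k * (2 * w * cnj a) / (w ^ 2 * w ^ 2)) (at z)"
    using w unfolding w_def by (auto intro!: derivative_eq_intros)
  also have "k * (2 * w * cnj a) / (w ^ 2 * w ^ 2) = 2 * k * cnj a / w ^ 3"
    using w by (simp add: field_simps power2_eq_square power3_eq_cube)
  finally show ?thesis
    by (simp add: besov_atom'_def [abs_def] besov_atom''_def k_def w_def power2_eq_square mult.assoc del: of_real_diff)
qed

lemma norm_besov_atom_le: "norm (besov_atom a z) \<le> 2"
proof -
  let ?w = "norm (1 - cnj a * z)"
  have "1 - (norm a)\<^sup>2 \<le> 2 * ?w"
    by (rule order.trans[OF one_minus_norm_sq_bounds(2)[OF a]])
      (use norm_one_minus_cnj_mult_ge(1)[OF a z] in simp)
  moreover have "0 < ?w" using one_minus_cnj_mult_nonzero by simp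
  moreover have "norm (besov_atom a z) = (1 - (norm a)\<^sup>2) / ?w"
    using one_minus_norm_sq_bounds(1)[OF a]
    by (simp only: besov_atom_def norm_divide norm_of_real)
  ultimately show ?thesis by (simp add: divide_le_eq)
qed

lemma norm_besov_atom':
  "norm (besov_atom' a z) = (1 - (norm a)\<^sup>2) * norm a / norm (1 - cnj a * z) ^ 2"
  using one_minus_norm_sq_bounds(1)[OF a]
  by (simp only: besov_atom'_def norm_divide norm_mult norm_power norm_of_real complex_mod_cnj)

text \<open>The lower bound \<open>e\<close> is left free so that either \<open>1 - norm a\<close>
  or \<open>1 - norm z\<close> can be inserted.\<close>

lemma norm_besov_atom'_le:
  assumes "0 < e" "e \<le> norm (1 - cnj a * z)"
  shows "norm (besov_atom' a z) \<le> 2 * (1 - norm a) / e\<^sup>2"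
proof -
  have "(1 - (norm a)\<^sup>2) * norm a \<le> (2 * (1 - norm a)) * 1"
    using a one_minus_norm_sq_bounds[OF a] by (intro mult_mono) auto
  then show ?thesis unfolding norm_besov_atom'
    using assms a by (intro frac_le power_mono) auto
qed

text \<open>The right-hand side is shaped to be 4 times the integrand of
  \<open>nn_integral_kernel_le\<close>.\<close>

lemma norm_besov_atom''_le: "norm (besov_atom'' a z) \<le> 4 * ((1 - norm a) / norm (1 - cnj a * z) ^ 3)"
proof -
  have "norm (besov_atom'' a z) = 2 * (1 - (norm a)\<^sup>2) * (norm a)\<^sup>2 / norm (1 - cnj a * z) ^ 3"
    using one_minus_norm_sq_bounds(1)[OF a]
    by (simp only: besov_atom''_def norm_divide norm_mult norm_power norm_of_real complex_mod_cnj
        norm_numeral)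
  also have "2 * (1 - (norm a)\<^sup>2) * (norm a)\<^sup>2 \<le> (4 * (1 - norm a)) * 1"
    using a one_minus_norm_sq_bounds[OF a] by (intro mult_mono[of "2 * _"]) (auto simp: power_le_one)
  finally show ?thesis by (simp add: divide_right_mono)
qed

end

text \<open>At \<open>z = a\<close> the kernel equals \<open>1 - |a|^2\<close>, so every power of it
  cancels. This is the hump: it does not shrink as \<open>a\<close> approaches the circle.\<close>

lemma besov_atom'_diagonal:
  assumes "norm a < 1"
  shows "(1 - (norm a)\<^sup>2) * norm (besov_atom' a a) = norm a"
proof -
  have p: "0 < 1 - (norm a)\<^sup>2" by (rule one_minus_norm_sq_bounds(1)[OF assms])
  have "1 - cnj a * a = of_real (1 - (norm a)\<^sup>2)"
    by (simp only: of_real_diff of_real_1 complex_norm_square mult.commute)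
  then have "norm (1 - cnj a * a) = 1 - (norm a)\<^sup>2"
    using p by (metis abs_of_pos norm_of_real)
  with p show ?thesis by (simp add: norm_besov_atom'[OF assms assms] power2_eq_square[of "1 - _"])
qed

section \<open>Weighted series of atoms and their membership in the minimal Besov space\<close>

context
  fixes c :: "nat \<Rightarrow> real" and a :: "nat \<Rightarrow> complex"
  assumes c: "summable c" "\<And>n. 0 \<le> c n"
    and a: "\<And>n. 1 / 2 \<le> norm (a n)" "\<And>n. norm (a n) < 1"
begin

lemma atom_series_deriv:
  assumes "norm z < 1"
  shows "((\<lambda>z. \<Sum>n. of_real (c n) * besov_atom (a n) z)
     has_field_derivative (\<Sum>n. of_real (c n) * besov_atom' (a n) z)) (at z)"
proof (rule has_field_derivative_suminf_ball[where M = c and C = "\<lambda>r. 2 / (1 - r)\<^sup>2"])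
  fix n and z :: complex assume z: "norm z < 1"
  show "((\<lambda>z. of_real (c n) * besov_atom (a n) z) has_field_derivative
      of_real (c n) * besov_atom' (a n) z) (at z)"
    by (intro DERIV_cmult besov_atom_deriv a z)
  \<comment> \<open>Taking \<open>e = 1 - norm z\<close> gives a bound free of \<open>a n\<close>,
    as the M-test requires.\<close>
  have "norm (besov_atom' (a n) z) \<le> 2 * (1 - norm (a n)) / (1 - norm z)\<^sup>2"
    using z by (intro norm_besov_atom'_le norm_one_minus_cnj_mult_ge(2) a) auto
  also have "\<dots> \<le> 2 / (1 - norm z)\<^sup>2" by (intro divide_right_mono) auto
  finally show "norm (of_real (c n) * besov_atom' (a n) z) \<le> c n * (2 / (1 - norm z)\<^sup>2)"
    using c by (simp only: norm_mult norm_of_real abs_of_nonneg mult_left_mono)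
next
  show "mono_on {..<1} (\<lambda>r. 2 / (1 - r)\<^sup>2 :: real)"
    by (intro mono_onI divide_left_mono power_mono) auto
  have "summable (\<lambda>n. of_real (c n) * besov_atom (a n) 0 :: complex)"
  proof (rule summable_comparison_test')
    show "summable (\<lambda>n. c n * 2)" using c by (intro summable_mult2)
    show "norm (of_real (c n) * besov_atom (a n) 0) \<le> c n * 2" for n
      unfolding norm_mult using c norm_besov_atom_le[OF a(2), of 0 n] by (intro mult_mono) auto
  qed
  then show "summable (\<lambda>n. of_real (c n) * besov_atom (a n) 0 :: complex)" .
qed (use assms c in auto)

lemma norm_atom_series_le:
  assumes "norm z < 1"
  shows "norm (\<Sum>n. of_real (c n) * besov_atom (a n) z) \<le> 2 * suminf c"
proof -
  have *: "norm (of_real (c n) * besov_atom (a n) z) \<le> 2 * c n" for n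
    unfolding norm_mult using c norm_besov_atom_le[OF a(2) assms, of n]
    by (subst mult.commute, intro mult_mono) auto
  have "norm (\<Sum>n. of_real (c n) * besov_atom (a n) z) \<le> (\<Sum>n. 2 * c n)"
    using c by (intro norm_suminf_le summable_mult * )
  then show ?thesis using c by (simp add: suminf_mult)
qed

lemma atom_series_deriv2:
  assumes "norm z < 1"
  shows "((\<lambda>z. \<Sum>n. of_real (c n) * besov_atom' (a n) z)
     has_field_derivative (\<Sum>n. of_real (c n) * besov_atom'' (a n) z)) (at z)"
proof (rule has_field_derivative_suminf_ball[where M = c and C = "\<lambda>r. 4 / (1 - r) ^ 3"])
  fix n and z :: complex assume z: "norm z < 1"
  show "((\<lambda>z. of_real (c n) * besov_atom' (a n) z) has_field_derivative
      of_real (c n) * besov_atom'' (a n) z) (at z)"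
    by (intro DERIV_cmult besov_atom'_deriv a z)
  have "norm (besov_atom'' (a n) z) \<le> 4 * ((1 - norm (a n)) / norm (1 - cnj (a n) * z) ^ 3)"
    by (intro norm_besov_atom''_le a z)
  also have "\<dots> \<le> 4 * (1 / (1 - norm z) ^ 3)"
    using norm_one_minus_cnj_mult_ge[OF a(2) z, of n] z a(2)[of n]
    by (intro mult_left_mono frac_le power_mono) auto
  finally have "norm (besov_atom'' (a n) z) \<le> 4 / (1 - norm z) ^ 3" by simp
  then show "norm (of_real (c n) * besov_atom'' (a n) z) \<le> c n * (4 / (1 - norm z) ^ 3)"
    using c by (simp only: norm_mult norm_of_real abs_of_nonneg mult_left_mono)
next
  show "mono_on {..<1} (\<lambda>r. 4 / (1 - r) ^ 3 :: real)"
    by (intro mono_onI divide_left_mono power_mono) auto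
  have "summable (\<lambda>n. of_real (c n) * besov_atom' (a n) 0 :: complex)"
  proof (rule summable_comparison_test')
    show "summable (\<lambda>n. c n * 2)" using c by (intro summable_mult2)
    show "norm (of_real (c n) * besov_atom' (a n) 0) \<le> c n * 2" for n
    proof -
      have "norm (besov_atom' (a n) 0) \<le> 2 * (1 - norm (a n)) / 1\<^sup>2"
        by (intro norm_besov_atom'_le a) auto
      also have "\<dots> \<le> 2" by simp
      finally show ?thesis unfolding norm_mult using c by (intro mult_mono) auto
    qed
  qed
  then show "summable (\<lambda>n. of_real (c n) * besov_atom' (a n) 0 :: complex)" .
qed (use assms c in auto)

text \<open>By monotone convergence the integral of the termwise bound is the sum of the integrals.
  Each kernel integral is at most \<open>32 * pi\<close>, so summability of the weights
  suffices.\<close>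

lemma atom_series_mem_min_besov_space:
  "(\<lambda>z. \<Sum>n. of_real (c n) * besov_atom (a n) z) \<in> min_besov_space"
proof -
  define g where "g = (\<lambda>z. \<Sum>n. of_real (c n) * besov_atom (a n) z)"
  define g' where "g' = (\<lambda>z. \<Sum>n. of_real (c n) * besov_atom' (a n) z)"
  have g: "(g has_field_derivative g' z) (at z)" if "z \<in> ball 0 1" for z
    unfolding g_def g'_def using that by (intro atom_series_deriv) simp
  have "g holomorphic_on ball 0 1" using g
    by (meson open_ball holomorphic_on_open)
  then have ana: "g analytic_on ball 0 1" by (simp add: analytic_on_open)
  have deriv2: "deriv (deriv g) z = (\<Sum>n. of_real (c n) * besov_atom'' (a n) z)"
    if "z \<in> ball 0 1" for z
  proof -
    have "deriv (deriv g) z = deriv g' z"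
      \<comment> \<open>\<open>deriv g\<close> is known to agree with \<open>g'\<close> only on the
        disc; openness makes them agree near \<open>z\<close>, which determines the
        derivative.\<close>
      by (intro deriv_cong_ev eventually_mono[OF eventually_nhds_in_open[OF open_ball that]])
        (auto intro!: DERIV_imp_deriv g)
    also have "\<dots> = (\<Sum>n. of_real (c n) * besov_atom'' (a n) z)"
      unfolding g'_def using that by (intro DERIV_imp_deriv atom_series_deriv2) simp
    finally show ?thesis .
  qed
  define K where "K n z = (1 - norm (a n)) / norm (1 - cnj (a n) * z) ^ 3" for n z
  have [measurable]: "ball 0 1 \<in> sets (borel :: complex measure)" by simp
  have K0: "0 \<le> K n z" for n z using a(2)[of n] by (simp add: K_def)
  have "(\<integral>\<^sup>+z\<in>ball 0 1. ennreal (norm (deriv (deriv g) z)) \<partial>lborel)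
      \<le> (\<integral>\<^sup>+z. (\<Sum>n. ennreal (4 * c n) * (ennreal (K n z) * indicator (ball 0 1) z)) \<partial>lborel)"
  proof (rule nn_integral_mono)
    fix z :: complex
    show "ennreal (norm (deriv (deriv g) z)) * indicator (ball 0 1) z
      \<le> (\<Sum>n. ennreal (4 * c n) * (ennreal (K n z) * indicator (ball 0 1) z))"
    proof (cases "z \<in> ball 0 1")
      case True
      then have z: "norm z < 1" by simp
      have bd: "norm (of_real (c n) * besov_atom'' (a n) z) \<le> 4 * c n * K n z" for n
        using mult_left_mono[OF norm_besov_atom''_le[OF a(2) z, of n] c(2)[of n]] c(2)[of n]
        by (simp add: norm_mult K_def mult_ac)
      \<comment> \<open>Convergence at a fixed \<open>z\<close> is needed to pass from the real
        series to the \<open>ennreal\<close> one; the crude bound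
        \<open>1 - norm (a n) \<le> 1\<close> is enough.\<close>
      have "summable (\<lambda>n. 4 * c n * K n z)"
      proof (rule summable_comparison_test')
        show "summable (\<lambda>n. 4 * c n * (1 / (1 - norm z) ^ 3))"
          using c by (intro summable_mult2 summable_mult)
        have "K n z \<le> 1 / (1 - norm z) ^ 3" for n
          unfolding K_def using norm_one_minus_cnj_mult_ge[OF a(2) z, of n] z a(2)[of n]
          by (intro frac_le power_mono) auto
        then have "4 * c n * K n z \<le> 4 * c n * (1 / (1 - norm z) ^ 3)" for n
          using c by (intro mult_left_mono) auto
        then show "norm (4 * c n * K n z) \<le> 4 * c n * (1 / (1 - norm z) ^ 3)" for n
          using c K0 by simp
      qed
      note sm = this
      have "norm (deriv (deriv g) z) \<le> (\<Sum>n. 4 * c n * K n z)"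
        unfolding deriv2[OF True] by (intro norm_suminf_le sm bd)
      then have "ennreal (norm (deriv (deriv g) z)) \<le> ennreal (\<Sum>n. 4 * c n * K n z)"
        by (rule ennreal_leI)
      also have "\<dots> = (\<Sum>n. ennreal (4 * c n * K n z))"
        using c K0 by (intro suminf_ennreal2[symmetric] sm) auto
      also have "\<dots> = (\<Sum>n. ennreal (4 * c n) * ennreal (K n z))"
        using c K0 by (simp add: ennreal_mult)
      finally show ?thesis using True by simp
    qed simp
  qed
  also have "\<dots> = (\<Sum>n. \<integral>\<^sup>+z. ennreal (4 * c n) * (ennreal (K n z) * indicator (ball 0 1) z) \<partial>lborel)"
    unfolding K_def by (intro nn_integral_suminf) measurable
  also have "\<dots> = (\<Sum>n. ennreal (4 * c n) * (\<integral>\<^sup>+z. ennreal (K n z) * indicator (ball 0 1) z \<partial>lborel))"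
    unfolding K_def by (intro suminf_cong nn_integral_cmult) measurable
  also have "\<dots> \<le> (\<Sum>n. ennreal (4 * c n) * ennreal (32 * pi))"
    unfolding K_def by (intro suminf_le mult_left_mono nn_integral_kernel_le a) auto
  also have "\<dots> = (\<Sum>n. ennreal (4 * c n * (32 * pi)))"
    using c by (intro suminf_cong ennreal_mult[symmetric]) auto
  also have "\<dots> = ennreal (\<Sum>n. 4 * c n * (32 * pi))"
    using c by (intro suminf_ennreal2 summable_mult2 summable_mult) auto
  also have "\<dots> < \<infinity>" by simp
  finally show ?thesis using ana by (simp add: min_besov_space_def g_def)
qed

end

section \<open>Bloch bounds and points where an unbounded function is large\<close>

lemma bloch_spaceD:
  assumes "f \<in> bloch_space"
  obtains M where "\<And>z. norm z < 1 \<Longrightarrow> (1 - (norm z)\<^sup>2) * norm (deriv f z) \<le> M"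
proof -
  define S where "S = (SUP z\<in>ball 0 1. ennreal ((1 - (norm z)\<^sup>2) * norm (deriv f z)))"
  have "S < \<infinity>" using assms by (auto simp: bloch_space_def S_def)
  show thesis
  proof (rule that)
    fix z :: complex assume z: "norm z < 1"
    have "ennreal ((1 - (norm z)\<^sup>2) * norm (deriv f z)) \<le> S"
      unfolding S_def using z by (intro SUP_upper) simp
    also have "S = ennreal (enn2real S)" using \<open>S < \<infinity>\<close> by simp
    finally show "(1 - (norm z)\<^sup>2) * norm (deriv f z) \<le> enn2real S"
      by simp
  qed
qed

text \<open>On the compact disc of radius \<open>1 - e\<close> the function is bounded, so any value
  exceeding that bound is attained in the remaining annulus. If \<open>e > 1\<close>, the closed
  disc is empty and the argument still holds.\<close>

lemma unbounded_near_boundary: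
  assumes "continuous_on (ball 0 1) f" "\<not> bounded (f ` ball 0 1)" "e > 0"
  obtains z :: complex where "norm z < 1" "1 - norm z \<le> e" "K \<le> norm (f z)"
proof -
  have "bounded (f ` cball 0 (1 - e))"
    using assms by (intro compact_imp_bounded compact_continuous_image)
      (auto intro: continuous_on_subset)
  then obtain B where "\<forall>z\<in>cball 0 (1 - e). norm (f z) \<le> B"
    by (auto simp: bounded_iff)
  then have B: "norm (f z) \<le> B" if "norm z \<le> 1 - e" for z
    using that by simp
  have "\<not> (\<forall>y\<in>f ` ball 0 1. norm y \<le> max B K)"
    using assms(2) unfolding bounded_iff by blast
  then obtain z where z: "norm z < 1" "max B K < norm (f z)"
    by (auto simp: not_le)
  then have "\<not> norm z \<le> 1 - e" using B[of z] by linarith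
  with z show thesis by (intro that[of z]) auto
qed

lemma rapid_sequence:
  assumes "continuous_on (ball 0 1) f" "\<not> bounded (f ` ball 0 1)"
  obtains a :: "nat \<Rightarrow> complex" where
    "\<And>n. norm (a n) < 1" "\<And>n. 1 / 2 \<le> norm (a n)" "\<And>n. 4 ^ n \<le> norm (f (a n))"
    "\<And>n. 1 - norm (a (Suc n)) \<le> (1 - norm (a n)) / 64"
proof -
  define P where "P n z \<longleftrightarrow> norm z < 1 \<and> 1 / 2 \<le> norm z \<and> 4 ^ n \<le> norm (f z)" for n and z :: complex
  have "\<exists>a. \<forall>n. P n (a n) \<and> 1 - norm (a (Suc n)) \<le> (1 - norm (a n)) / 64"
  proof (rule dependent_nat_choice)
    obtain z :: complex where "norm z < 1" "1 - norm z \<le> 1 / 2" "4 ^ 0 \<le> norm (f z)"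
      using unbounded_near_boundary[OF assms, of "1 / 2" "4 ^ 0"] by auto
    then show "\<exists>z. P 0 z" by (auto simp: P_def intro!: exI[of _ z])
  next
    fix x n assume "P n x"
    \<comment> \<open>The second inequality makes the next point satisfy
      \<open>1 / 2 \<le> norm z\<close> automatically.\<close>
    then have "0 < (1 - norm x) / 64" "(1 - norm x) / 64 \<le> 1 / 2" by (auto simp: P_def)
    moreover obtain z :: complex where "norm z < 1" "1 - norm z \<le> (1 - norm x) / 64" "4 ^ Suc n \<le> norm (f z)"
      using unbounded_near_boundary[OF assms \<open>0 < (1 - norm x) / 64\<close>] by blast
    ultimately show "\<exists>y. P (Suc n) y \<and> 1 - norm y \<le> (1 - norm x) / 64"
      by (auto simp: P_def intro!: exI[of _ z])
  qed
  then show thesis using that by (auto simp: P_def)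
qed

section \<open>The gliding hump estimate\<close>

text \<open>The terms before and those after index \<open>n\<close> are each dominated by
  \<open>B * (q + q^2 + ...) = B * (q / (1 - q))\<close>; the triangle inequality leaves the term at
  \<open>n\<close>.\<close>

lemma norm_suminf_ge_term:
  fixes x :: "nat \<Rightarrow> 'a::banach"
  assumes before: "\<And>k. k < n \<Longrightarrow> norm (x k) \<le> B * q ^ (n - k)"
    and after: "\<And>k. n < k \<Longrightarrow> norm (x k) \<le> B * q ^ (k - n)"
    and B: "0 \<le> B" and q: "0 \<le> q" "q < 1"
  shows "norm (x n) - 2 * B * (q / (1 - q)) \<le> norm (suminf x)"
proof -
  have geo: "summable (\<lambda>k. B * q ^ Suc k)" "(\<Sum>k. B * q ^ Suc k) = B * (q / (1 - q))"
  proof -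
    have "(\<lambda>k. B * q * q ^ k) sums (B * q * (1 / (1 - q)))"
      using q by (intro sums_mult geometric_sums) auto
    then have "(\<lambda>k. B * q ^ Suc k) sums (B * (q / (1 - q)))" by (simp add: mult.assoc)
    then show "summable (\<lambda>k. B * q ^ Suc k)" "(\<Sum>k. B * q ^ Suc k) = B * (q / (1 - q))"
      by (auto simp: sums_iff)
  qed
  have tail_le: "norm (x (k + Suc n)) \<le> B * q ^ Suc k" for k
    using after[of "k + Suc n"] by (simp add: Suc_diff_le)
  have tail_sm: "summable (\<lambda>k. x (k + Suc n))"
    using tail_le by (rule summable_comparison_test'[OF geo(1)])
  have tail: "norm (\<Sum>k. x (k + Suc n)) \<le> B * (q / (1 - q))"
    using norm_suminf_le[OF tail_le geo(1)] geo(2) by simp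
  have "norm (\<Sum>k<n. x k) \<le> (\<Sum>k<n. B * q ^ (n - k))"
    by (intro sum_norm_le before) simp
  also have "\<dots> = (\<Sum>k<n. B * q ^ Suc (n - Suc k))"
    by (intro sum.cong) (auto simp: Suc_diff_Suc)
  also have "\<dots> = (\<Sum>k<n. B * q ^ Suc k)"
    by (rule sum.nat_diff_reindex)
  also have "\<dots> \<le> B * (q / (1 - q))"
    using sum_le_suminf[OF geo(1), of "{..<n}"] B q geo(2) by auto
  finally have head: "norm (\<Sum>k<n. x k) \<le> B * (q / (1 - q))" .
  \<comment> \<open>Summability is not assumed; the geometric bound on the terms beyond
    \<open>n\<close> supplies it.\<close>
  have "summable x" using tail_sm by (subst (asm) summable_iff_shift)
  then have "suminf x = (\<Sum>k. x (k + Suc n)) + ((\<Sum>k<n. x k) + x n)"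
    using suminf_split_initial_segment[of x "Suc n"] by simp
  then have "x n = suminf x - ((\<Sum>k. x (k + Suc n)) + (\<Sum>k<n. x k))" by simp
  also have "norm \<dots> \<le> norm (suminf x) + norm ((\<Sum>k. x (k + Suc n)) + (\<Sum>k<n. x k))"
    by (rule norm_triangle_ineq4)
  also have "\<dots> \<le> norm (suminf x) + (B * (q / (1 - q)) + B * (q / (1 - q)))"
    by (intro add_left_mono norm_triangle_mono tail head)
  finally show ?thesis by simp
qed

lemma geometric_gap_le:
  fixes d :: "nat \<Rightarrow> real"
  assumes "\<And>n. d (Suc n) \<le> d n * r" "0 \<le> r"
  shows "d (n + j) \<le> d n * r ^ j"
proof (induction j)
  case (Suc j)
  have "d (n + Suc j) \<le> d (n + j) * r" using assms(1) by simp
  also have "\<dots> \<le> d n * r ^ j * r" using Suc assms(2) by (intro mult_right_mono)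
  finally show ?case by (simp add: mult_ac)
qed simp

text \<open>Since the points approach the circle rapidly, at \<open>a n\<close> the atom centred there
  dominates all the others.\<close>

lemma atom_series_deriv_lower_bound:
  fixes a :: "nat \<Rightarrow> complex"
  assumes a: "\<And>n. norm (a n) < 1" "\<And>n. 1 / 2 \<le> norm (a n)"
    and gap: "\<And>n. 1 - norm (a (Suc n)) \<le> (1 - norm (a n)) / 64"
  shows "(1 / 2) ^ n / 5 \<le> (1 - (norm (a n))\<^sup>2) * norm (\<Sum>k. of_real ((1 / 2) ^ k) * besov_atom' (a k) (a n))"
proof -
  define d where "d k = 1 - norm (a k)" for k
  have d: "0 < d k" for k using a by (simp add: d_def)
  have dj: "d (m + j) \<le> d m * (1 / 64) ^ j" for m j
    using gap by (intro geometric_gap_le) (auto simp: d_def)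
  define s where "s = 1 - (norm (a n))\<^sup>2"
  have s: "0 < s" "s \<le> 2 * d n"
    using one_minus_norm_sq_bounds[OF a(1), of n] by (auto simp: s_def d_def)
  \<comment> \<open>The factor \<open>s\<close> is absorbed into the terms, so that the diagonal one
    has norm \<open>(1 / 2) ^ n * norm (a n)\<close>.\<close>
  define x where "x k = of_real s * (of_real ((1 / 2) ^ k) * besov_atom' (a k) (a n))" for k
  have nx: "norm (x k) = s * (1 / 2) ^ k * norm (besov_atom' (a k) (a n))" for k
    using s by (simp add: x_def norm_mult norm_power)
  \<comment> \<open>For earlier atoms the kernel is at least \<open>d k\<close>, and
    \<open>s \<le> 2 * d n\<close> gains \<open>64 ^ (-j)\<close> relative to it. Comparing the
    weight \<open>(1 / 2) ^ k\<close> with \<open>(1 / 2) ^ n\<close> costs \<open>2 ^ j\<close>,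
    which leaves the ratio \<open>1 / 32\<close>.\<close>
  have before: "norm (x k) \<le> 4 * (1 / 2) ^ n * (1 / 32) ^ (n - k)" if "k < n" for k
  proof -
    obtain j where j: "n = k + j" using \<open>k < n\<close> less_imp_add_positive by blast
    have "norm (besov_atom' (a k) (a n)) \<le> 2 * d k / (d k)\<^sup>2"
      unfolding d_def by (intro norm_besov_atom'_le norm_one_minus_cnj_mult_ge(1) a) (use a in simp)
    also have "\<dots> = 2 / d k" by (simp add: power2_eq_square)
    finally have "norm (x k) \<le> (2 * (d k * (1 / 64) ^ j)) * (1 / 2) ^ k * (2 / d k)"
      unfolding nx using s d[of k] dj[of k j] by (intro mult_mono) (auto simp: j)
    also have "\<dots> = 4 * (1 / 2) ^ k * (1 / 64) ^ j" using d[of k] by simp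
    also have "(1 / 64 :: real) ^ j = (1 / 2) ^ j * (1 / 32) ^ j"
      by (simp add: power_mult_distrib[symmetric])
    finally show ?thesis by (simp add: j power_add mult_ac)
  qed
  \<comment> \<open>For later atoms the kernel is at least \<open>d n\<close> and the gain sits in
    the numerator \<open>d k\<close>. The weights decay as well; the ratio is weakened to
    \<open>1 / 32\<close> to match the other side.\<close>
  have after: "norm (x k) \<le> 4 * (1 / 2) ^ n * (1 / 32) ^ (k - n)" if "n < k" for k
  proof -
    obtain j where j: "k = n + j" using \<open>n < k\<close> less_imp_add_positive by blast
    have "norm (besov_atom' (a k) (a n)) \<le> 2 * d k / (d n)\<^sup>2"
      unfolding d_def by (intro norm_besov_atom'_le norm_one_minus_cnj_mult_ge(2) a) (use a in simp)
    also have "\<dots> \<le> 2 * (d n * (1 / 64) ^ j) / (d n)\<^sup>2"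
      using dj[of n j] by (intro divide_right_mono) (auto simp: j)
    finally have "norm (x k) \<le> (2 * d n) * (1 / 2) ^ k * (2 * (d n * (1 / 64) ^ j) / (d n)\<^sup>2)"
      unfolding nx using s d[of n] by (intro mult_mono) auto
    also have "\<dots> = 4 * (1 / 2) ^ n * ((1 / 2) ^ j * (1 / 64) ^ j)"
      using d[of n] by (simp add: j power_add power2_eq_square)
    also have "(1 / 2) ^ j * (1 / 64) ^ j \<le> (1 :: real) * (1 / 32) ^ j"
      by (intro mult_mono power_mono) (auto intro: power_le_one)
    finally show ?thesis by (simp add: j)
  qed
  have sm: "summable (\<lambda>k. of_real ((1 / 2) ^ k) * besov_atom' (a k) (a n))"
  proof (rule summable_comparison_test')
    show "summable (\<lambda>k. (1 / 2) ^ k * (2 / (d n)\<^sup>2))" by (intro summable_mult2 summable_geometric) simp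
    fix k
    have "norm (besov_atom' (a k) (a n)) \<le> 2 * d k / (d n)\<^sup>2"
      unfolding d_def by (intro norm_besov_atom'_le norm_one_minus_cnj_mult_ge(2) a) (use a in simp)
    also have "\<dots> \<le> 2 / (d n)\<^sup>2" by (intro divide_right_mono) (auto simp: d_def)
    finally show "norm (of_real ((1 / 2) ^ k) * besov_atom' (a k) (a n)) \<le> (1 / 2) ^ k * (2 / (d n)\<^sup>2)"
      unfolding norm_mult by (intro mult_mono) (auto simp: norm_power)
  qed
  define p :: real where "p = (1 / 2) ^ n"
  \<comment> \<open>The two sides together cost \<open>8 / 31 * p\<close>, while the diagonal term
    is at least \<open>p / 2\<close>; the difference \<open>15 / 62 * p\<close> exceeds
    \<open>p / 5\<close>.\<close>
  have "norm (x n) - 2 * (4 * p) * ((1 / 32) / (1 - 1 / 32)) \<le> norm (suminf x)"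
    unfolding p_def by (intro norm_suminf_ge_term before after) auto
  then have "norm (x n) - 8 / 31 * p \<le> norm (suminf x)" by simp
  moreover have "norm (x n) = p * norm (a n)"
    using besov_atom'_diagonal[OF a(1)[of n]] by (simp add: nx s_def p_def mult_ac)
  moreover have "p * (1 / 2) \<le> p * norm (a n)"
    by (intro mult_left_mono a) (simp add: p_def)
  moreover have "0 \<le> p" by (simp add: p_def)
  ultimately have "p / 5 \<le> norm (suminf x)" by linarith
  also have "norm (suminf x) = s * norm (\<Sum>k. of_real ((1 / 2) ^ k) * besov_atom' (a k) (a n))"
    unfolding x_def using s by (subst suminf_mult[OF sm]) (simp add: norm_mult)
  finally show ?thesis unfolding s_def p_def .
qed

section \<open>The product with the atom series leaves the Bloch space\<close>

theorem theorem1p4: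
  fixes f :: "complex \<Rightarrow> complex"
  assumes "f \<in> bloch_space - H_infinity"
  shows "\<exists>g \<in> min_besov_space. (\<lambda>z. g z * f z) \<notin> bloch_space"
proof -
  have f_bloch: "f \<in> bloch_space" and ana: "f analytic_on ball 0 1" and unb: "\<not> bounded (f ` ball 0 1)"
    using assms by (auto simp: bloch_space_def H_infinity_def)
  have hol: "f holomorphic_on ball 0 1" using ana by (simp add: analytic_on_open)
  obtain a where a: "\<And>n. norm (a n) < 1" "\<And>n. 1 / 2 \<le> norm (a n)" "\<And>n. 4 ^ n \<le> norm (f (a n))"
    and gap: "\<And>n. 1 - norm (a (Suc n)) \<le> (1 - norm (a n)) / 64"
    using rapid_sequence[OF holomorphic_on_imp_continuous_on[OF hol] unb] by blast
  define g where "g = (\<lambda>z. \<Sum>n. of_real ((1 / 2) ^ n) * besov_atom (a n) z)"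
  define g' where "g' = (\<lambda>z. \<Sum>n. of_real ((1 / 2) ^ n) * besov_atom' (a n) z)"
  have c: "summable (\<lambda>n. (1 / 2) ^ n :: real)" "\<And>n. (0::real) \<le> (1 / 2) ^ n" by auto
  have "(\<lambda>z. g z * f z) \<notin> bloch_space"
  proof
    assume "(\<lambda>z. g z * f z) \<in> bloch_space"
    then obtain M where M: "\<And>z. norm z < 1 \<Longrightarrow> (1 - (norm z)\<^sup>2) * norm (deriv (\<lambda>z. g z * f z) z) \<le> M"
      using bloch_spaceD by blast
    obtain N where N: "\<And>z. norm z < 1 \<Longrightarrow> (1 - (norm z)\<^sup>2) * norm (deriv f z) \<le> N"
      using bloch_spaceD f_bloch by blast
    \<comment> \<open>The product rule isolates \<open>g' * f\<close>: the derivative of the product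
      contributes \<open>M\<close>, and \<open>g * f'\<close> contributes \<open>4 * N\<close>,
      since \<open>|g| \<le> 2 * (1 + 1/2 + 1/4 + ...) = 4\<close>.\<close>
    have bound: "(1 - (norm z)\<^sup>2) * norm (g' z) * norm (f z) \<le> M + 4 * N" if z: "norm z < 1" for z
    proof -
      define s where "s = 1 - (norm z)\<^sup>2"
      have s: "0 < s" using one_minus_norm_sq_bounds(1)[OF z] by (simp add: s_def)
      have "(g has_field_derivative g' z) (at z)"
        unfolding g_def g'_def by (rule atom_series_deriv[OF c a(2,1) z])
      moreover have "(f has_field_derivative deriv f z) (at z)"
        using z by (intro holomorphic_derivI[OF hol]) auto
      ultimately have "deriv (\<lambda>z. g z * f z) z = g' z * f z + deriv f z * g z"
        by (intro DERIV_imp_deriv DERIV_mult)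
      then have "norm (g' z * f z) \<le> norm (deriv (\<lambda>z. g z * f z) z) + norm (deriv f z * g z)"
        using norm_triangle_ineq4[of "deriv (\<lambda>z. g z * f z) z" "deriv f z * g z"] by simp
      then have "norm (g' z) * norm (f z) \<le> norm (deriv (\<lambda>z. g z * f z) z) + norm (deriv f z) * norm (g z)"
        by (simp only: norm_mult)
      then have "s * (norm (g' z) * norm (f z))
          \<le> s * (norm (deriv (\<lambda>z. g z * f z) z) + norm (deriv f z) * norm (g z))"
        using s by (intro mult_left_mono) auto
      moreover have "s * norm (deriv f z) * norm (g z) \<le> N * 4"
      proof (rule mult_mono)
        have "norm (g z) \<le> 2 * (\<Sum>n. (1 / 2) ^ n)"
          unfolding g_def by (rule norm_atom_series_le[OF c a(2,1) z])
        then show "norm (g z) \<le> 4" by (simp add: suminf_geometric)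
        \<comment> \<open>\<open>N\<close> dominates a nonnegative quantity at
          \<open>z\<close>.\<close>
        show "0 \<le> N" using N[OF z] s by (auto simp: s_def intro: order_trans[rotated])
      qed (use N[OF z] in \<open>auto simp: s_def\<close>)
      moreover have "s * norm (deriv (\<lambda>z. g z * f z) z) \<le> M" using M[OF z] by (simp add: s_def)
      ultimately show ?thesis unfolding s_def[symmetric] by (simp add: algebra_simps)
    qed
    \<comment> \<open>At \<open>a n\<close> the growth \<open>4 ^ n\<close> of \<open>f\<close>
      outweighs the hump size \<open>(1 / 2) ^ n / 5\<close>, giving \<open>2 ^ n / 5\<close> under
      a fixed bound.\<close>
    have "2 ^ n \<le> 5 * (M + 4 * N)" for n :: nat
    proof -
      have "(1 / 2) ^ n / 5 * 4 ^ n \<le> (1 - (norm (a n))\<^sup>2) * norm (g' (a n)) * norm (f (a n))"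
        unfolding g'_def using one_minus_norm_sq_bounds(1)[OF a(1), of n]
        by (intro mult_mono atom_series_deriv_lower_bound a gap) auto
      also have "\<dots> \<le> M + 4 * N" by (intro bound a)
      also have "(1 / 2) ^ n / 5 * 4 ^ n = (2 ^ n / 5 :: real)"
        by (simp add: power_mult_distrib[symmetric])
      finally show ?thesis by simp
    qed
    then show False
      using real_arch_pow[of 2 "5 * (M + 4 * N)"] by (auto simp: not_le[symmetric])
  qed
  moreover have "g \<in> min_besov_space"
    unfolding g_def by (rule atom_series_mem_min_besov_space[OF c a(2,1)])
  ultimately show ?thesis by blast
qed

end
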